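(* Let $p$ be a prime and $a,b,c$ positive integers such that $c$ is a primitive divisor of $p^a-1$ and $bc$ is a primitive divisor of $p^{ab}-1$. Then $$w\!\left(\tfrac{p^{ab}-1}{bc},p^{ab}\right)=b\, w\!\left(\tfrac{p^a-1}{c},p^a\right).$$
   Context: An integer $d$ is a primitive divisor of $p^n-1$ if $d\mid p^n-1$ and $d\nmid p^t-1$ for all $1\le t<n$. For a prime power $q$ and $k\in\mathbb{N}$, the weak Waring number $w(k,q)$ is the least $s\in\mathbb{N}$ (if it exists) such that every $a\in\mathbb{F}_q$ can be written as $a=\pm x_1^k\pm\cdots\pm x_s^k$ with $x_i\in\mathbb{F}_q$ and independent choices of signs. *)

theory Defs
  imports "HOL-Library.Cardinality" "HOL-Computational_Algebra.Primes"
begin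

definition primitive_divisor :: "nat \<Rightarrow> nat \<Rightarrow> nat \<Rightarrow> bool" where
  "primitive_divisor d p n \<longleftrightarrow>
     d dvd p ^ n - 1 \<and> (\<forall>t. 1 \<le> t \<and> t < n \<longrightarrow> \<not> d dvd p ^ t - 1)"

text \<open>
  The field with \<open>q\<close> elements enters as an arbitrary finite field type of cardinality \<open>q\<close>;
  the signs are the elements \<open>1\<close> and \<open>- 1\<close> of that field.
\<close>

definition all_signed_power_sums :: "'a::{finite,field} itself \<Rightarrow> nat \<Rightarrow> nat \<Rightarrow> bool" where
  "all_signed_power_sums TYPE('a) k s \<longleftrightarrow>
     (\<forall>y::'a. \<exists>e x :: nat \<Rightarrow> 'a.
        (\<forall>i<s. e i \<in> {1, - 1}) \<and> y = (\<Sum>i<s. e i * x i ^ k))"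

definition weak_waring_exists :: "'a::{finite,field} itself \<Rightarrow> nat \<Rightarrow> bool" where
  "weak_waring_exists TYPE('a) k \<longleftrightarrow> (\<exists>s. all_signed_power_sums TYPE('a) k s)"

text \<open>Only meaningful when \<^const>\<open>weak_waring_exists\<close> holds.\<close>

definition weak_waring :: "'a::{finite,field} itself \<Rightarrow> nat \<Rightarrow> nat" where
  "weak_waring TYPE('a) k = (LEAST s. all_signed_power_sums TYPE('a) k s)"

end

theory Submission
  imports
    "HOL-Algebra.Algebraic_Closure_Type"
    "HOL-Computational_Algebra.Polynomial"
    Defs
begin

text \<open>
  If \<open>k * d = q - 1\<close>, the \<open>k\<close>-th powers in a field with \<open>q\<close> elements are \<open>0\<close> and the \<open>d\<close>-th roots
  of unity. Primitivity of \<open>d\<close> says that these roots lie in no proper subfield, so the subring of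
  their signed sums is everything. Embed the field \<open>K\<close> with \<open>p\<^sup>a\<close> elements into the field \<open>L\<close> with
  \<open>p\<^sup>a\<^sup>b\<close> elements and let \<open>w \<in> L\<close> have order \<open>b * c\<close>. Since \<open>w\<^sup>b\<close> is a \<open>c\<close>-th root of unity, every
  power of \<open>w\<close> is \<open>x * w\<^sup>i\<close> with \<open>x\<^sup>c = 1\<close> in \<open>K\<close> and \<open>i < b\<close>. Hence \<open>1, w, \<dots>, w\<^sup>b\<^sup>-\<^sup>1\<close> spans \<open>L\<close> over \<open>K\<close>
  and, by counting, is a basis. The number of terms needed in \<open>L\<close> is therefore the sum of the numbers
  needed for the \<open>b\<close> coordinates, and the worst case is an element all of whose coordinates are
  worst cases in \<open>K\<close>.
\<close>

section \<open>Multiplicative group and roots of unity of a finite field\<close>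

lemma nat_pow_ring_of_type_algebra:
  "x [^]\<^bsub>ring_of_type_algebra\<^esub> (n::nat) = (x :: 'a::comm_ring_1) ^ n"
proof -
  interpret ring "ring_of_type_algebra :: 'a ring" by (rule ring_from_type_algebra)
  show ?thesis
    by (induction n) (simp_all add: ring_of_type_algebra_def flip: power_Suc2)
qed

text \<open>Multiplication by \<open>x\<close> permutes \<open>R - {0}\<close>, so the product of
  the nonzero elements absorbs the factor \<open>x ^ (card R - 1)\<close>. The form for subsets
  serves both the whole field and the subring of signed sums.\<close>

lemma finite_subring_power_eq_1:
  fixes R :: "'a::{finite,field} set"
  assumes "0 \<in> R" "\<And>x y. x \<in> R \<Longrightarrow> y \<in> R \<Longrightarrow> x * y \<in> R" "x \<in> R" "x \<noteq> 0"
  shows "x ^ (card R - 1) = 1"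
proof -
  let ?S = "R - {0}"
  have "inj_on ((*) x) ?S" using assms(4) by (auto intro!: inj_onI)
  moreover have "(*) x ` ?S = ?S"
    using assms by (intro card_subset_eq) (auto simp: card_image inj_on_def)
  ultimately have "(\<Prod>y\<in>?S. y) = (\<Prod>y\<in>?S. x * y)"
    using prod.reindex[of "(*) x" ?S "\<lambda>y. y"] by (simp add: comp_def)
  also have "\<dots> = x ^ card ?S * (\<Prod>y\<in>?S. y)"
    by (simp add: prod.distrib)
  finally show ?thesis
    using assms(1) by (simp add: card_Diff_singleton)
qed

lemma finite_field_power_eq_1:
  fixes x :: "'a::{finite,field}"
  assumes "x \<noteq> 0"
  shows "x ^ (CARD('a) - 1) = 1"
  using finite_subring_power_eq_1[of UNIV x] assms by simp

lemma finite_field_card_gt_1: "CARD('a::{finite,field}) > 1"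
proof -
  have "card {0, 1 :: 'a} \<le> CARD('a)"
    by (intro card_mono) auto
  then show ?thesis by simp
qed

text \<open>Existence of \<open>g\<close> is the cyclicity of the multiplicative group, transferred
  from the record-based rings of HOL-Algebra; the order of \<open>g\<close> then follows by counting
  its powers.\<close>

lemma finite_field_generator:
  obtains g :: "'a::{finite,field}"
  where "g \<noteq> 0" and "\<And>x. x \<noteq> 0 \<Longrightarrow> \<exists>m. x = g ^ m"
    and "\<And>m. g ^ m = 1 \<longleftrightarrow> CARD('a) - 1 dvd m"
proof -
  let ?R = "ring_of_type_algebra :: 'a ring"
  interpret field ?R by (rule field_from_type_algebra)
  have "finite (carrier ?R)" by simp
  from finite_field_mult_group_has_gen[OF this]
  obtain g where g: "g \<in> carrier (mult_of ?R)"
    "carrier (mult_of ?R) = {g [^]\<^bsub>?R\<^esub> i | i::nat. i \<in> UNIV}"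
    by (auto simp: nat_pow_mult_of)
  have "carrier (mult_of ?R) = UNIV - {0}"
    by (auto simp: mult_of_def ring_of_type_algebra_def)
  with g have g0: "g \<noteq> 0" and gen: "UNIV - {0} = {g ^ i | i. i \<in> UNIV}"
    by (auto simp: nat_pow_ring_of_type_algebra)
  have *: "\<exists>m. x = g ^ m" if "x \<noteq> 0" for x
  proof -
    have "x \<in> UNIV - {0}" using that by simp
    then show ?thesis unfolding gen by auto
  qed
  let ?q = "CARD('a) - 1"
  have q: "g ^ ?q = 1" by (rule finite_field_power_eq_1[OF g0])
  have qpos: "?q > 0" using finite_field_card_gt_1[where 'a = 'a] by simp
  have mod: "g ^ (i mod m) = g ^ i" if "g ^ m = 1" for i m
  proof -
    have "g ^ i = g ^ (m * (i div m) + i mod m)" by simp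
    also have "\<dots> = g ^ (i mod m)" unfolding power_add power_mult that by simp
    finally show ?thesis by simp
  qed
  \<comment> \<open>If \<open>g ^ m = 1\<close>, the powers with exponent below \<open>m\<close>
    exhaust the nonzero elements, so there are at most \<open>m\<close> of these.\<close>
  have min: "?q \<le> m" if "g ^ m = 1" "m > 0" for m
  proof -
    have "UNIV - {0} \<subseteq> (\<lambda>i. g ^ i) ` {..<m}"
    proof
      fix x assume "x \<in> UNIV - {0 :: 'a}"
      then obtain i where "x = g ^ i" using * by auto
      then have "x = g ^ (i mod m)" using mod[OF that(1)] by simp
      then show "x \<in> (\<lambda>i. g ^ i) ` {..<m}" using that(2) by auto
    qed
    then have "card (UNIV - {0 :: 'a}) \<le> card {..<m}"
      by (rule surj_card_le[rotated]) simp
    then show ?thesis by (simp add: card_Diff_singleton)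
  qed
  have "g ^ m = 1 \<longleftrightarrow> ?q dvd m" for m
  proof
    assume "g ^ m = 1"
    then have "g ^ (m mod ?q) = 1" using mod[OF q] by simp
    moreover have "m mod ?q < ?q" using qpos by (rule mod_less_divisor)
    ultimately have "m mod ?q = 0" using min[of "m mod ?q"] by linarith
    then show "?q dvd m" by (rule dvd_eq_mod_eq_0[THEN iffD2])
  next
    assume "?q dvd m"
    then obtain j where "m = ?q * j" ..
    then show "g ^ m = 1" using q by (simp only: power_mult power_one)
  qed
  with g0 * show ?thesis by (rule that)
qed

definition unity_roots :: "nat \<Rightarrow> 'a::field set" where
  "unity_roots d = {x. x ^ d = 1}"

text \<open>With \<open>CARD('a) - 1 = d * k\<close> and a generator \<open>g\<close> of the
  multiplicative group, \<open>w = g ^ k\<close> has order \<open>d\<close>. If \<open>g ^ m\<close>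
  is a \<open>d\<close>-th root of unity, then \<open>k * d dvd m * d\<close>, so
  \<open>g ^ m\<close> is a power of \<open>w\<close>.\<close>

lemma unity_roots_cyclic:
  assumes "d dvd CARD('a::{finite,field}) - 1"
  obtains w :: "'a::{finite,field}" where "\<And>m. w ^ m = 1 \<longleftrightarrow> d dvd m"
    and "unity_roots d = range (\<lambda>m. w ^ m)" and "w \<noteq> 0"
proof -
  obtain k where k: "CARD('a) - 1 = d * k" using assms by auto
  have pos: "d > 0" "k > 0"
    using k finite_field_card_gt_1[where 'a = 'a] by (auto intro: Nat.gr0I)
  obtain g :: 'a where g: "g \<noteq> 0" "\<And>x. x \<noteq> 0 \<Longrightarrow> \<exists>m. x = g ^ m"
    "\<And>m. g ^ m = 1 \<longleftrightarrow> CARD('a) - 1 dvd m"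
    using finite_field_generator[where 'a = 'a] by blast
  define w where "w = g ^ k"
  have w: "w ^ m = 1 \<longleftrightarrow> d dvd m" for m
    using g(3)[of "k * m"] pos unfolding k w_def power_mult[symmetric] mult.commute[of d] by simp
  have "unity_roots d = range (\<lambda>m. w ^ m)"
  proof (intro equalityI subsetI)
    fix x :: 'a assume "x \<in> unity_roots d"
    then have x: "x ^ d = 1" by (simp add: unity_roots_def)
    then have "x \<noteq> 0" using pos by (auto simp: power_0_left)
    then obtain m where m: "x = g ^ m" using g(2) by blast
    with x have "g ^ (m * d) = 1" by (simp add: power_mult)
    then have "k * d dvd m * d" unfolding g(3) k by (simp add: mult.commute)
    then have "k dvd m" using pos by simp
    then show "x \<in> range (\<lambda>m. w ^ m)"
      using m by (auto simp: w_def dvd_def power_mult)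
  next
    fix x assume "x \<in> range (\<lambda>m. w ^ m)"
    then obtain m where "x = w ^ m" by blast
    then have "x ^ d = w ^ (m * d)" by (simp only: power_mult)
    then show "x \<in> unity_roots d" using w[of "m * d"] by (simp add: unity_roots_def)
  qed
  moreover have "w \<noteq> 0" using g(1) by (simp add: w_def)
  ultimately show ?thesis using w by (intro that)
qed

lemma card_unity_roots:
  assumes "d dvd CARD('a::{finite,field}) - 1"
  shows "card (unity_roots d :: 'a set) = d"
proof -
  obtain w :: 'a where w: "\<And>m. w ^ m = 1 \<longleftrightarrow> d dvd m"
    "unity_roots d = range (\<lambda>m. w ^ m)" "w \<noteq> 0"
    using unity_roots_cyclic[OF assms] by blast
  have pos: "d > 0"
    using assms finite_field_card_gt_1[where 'a = 'a] by (auto intro: Nat.gr0I)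
  have "range (\<lambda>m. w ^ m) = (\<lambda>m. w ^ m) ` {..<d}"
  proof (intro equalityI subsetI)
    fix x assume "x \<in> range (\<lambda>m. w ^ m)"
    then obtain m where "x = w ^ (d * (m div d) + m mod d)" by auto
    then have "x = w ^ (m mod d)"
      unfolding power_add power_mult using w(1)[of d] by simp
    then show "x \<in> (\<lambda>m. w ^ m) ` {..<d}" using pos by auto
  qed auto
  moreover have "i = j" if "w ^ i = w ^ j" "i \<le> j" "j < d" for i j
  proof -
    have "w ^ j = w ^ i * w ^ (j - i)" using that(2) by (simp flip: power_add)
    with that w(3) have "w ^ (j - i) = 1" by simp
    then have "d dvd j - i" using w(1) by simp
    moreover have "j - i < d" using that(3) by simp
    ultimately have "j - i = 0" using dvd_imp_le linorder_not_less by blast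
    then show ?thesis using that(2) by simp
  qed
  then have "inj_on (\<lambda>m. w ^ m) {..<d}"
    by (intro inj_onI) (metis lessThan_iff linorder_le_cases)
  ultimately show ?thesis by (simp add: w(2) card_image)
qed

section \<open>Sumsets and signed sums of powers\<close>

text \<open>Zero is included because it is itself a \<open>k\<close>-th power; this also makes
  \<open>nsum (signed A)\<close> increasing in the number of terms.\<close>

definition signed :: "'a::ab_group_add set \<Rightarrow> 'a set" where
  "signed A = insert 0 (A \<union> uminus ` A)"

text \<open>The \<open>n\<close>-fold sumset of \<open>A\<close>, with exactly \<open>n\<close>
  summands.\<close>

primrec nsum :: "'a::comm_monoid_add set \<Rightarrow> nat \<Rightarrow> 'a set" where
  "nsum A 0 = {0}"
| "nsum A (Suc n) = {z + x | z x. z \<in> nsum A n \<and> x \<in> A}"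

lemma nsum_iff: "y \<in> nsum A n \<longleftrightarrow> (\<exists>f. (\<forall>i<n. f i \<in> A) \<and> y = (\<Sum>i<n. f i))"
proof (induction n arbitrary: y)
  case (Suc n)
  show ?case
  proof
    assume "y \<in> nsum A (Suc n)"
    then obtain z x where "z \<in> nsum A n" "x \<in> A" "y = z + x" by auto
    moreover from this obtain f where "\<forall>i<n. f i \<in> A" "z = (\<Sum>i<n. f i)"
      using Suc.IH by blast
    ultimately have "\<forall>i<n. f i \<in> A" "x \<in> A" "y = (\<Sum>i<n. f i) + x" by auto
    then show "\<exists>f. (\<forall>i<Suc n. f i \<in> A) \<and> y = (\<Sum>i<Suc n. f i)"
      by (intro exI[of _ "f(n := x)"]) (auto simp: less_Suc_eq)
  next
    assume "\<exists>f. (\<forall>i<Suc n. f i \<in> A) \<and> y = (\<Sum>i<Suc n. f i)"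
    then obtain f where f: "\<forall>i<Suc n. f i \<in> A" "y = (\<Sum>i<Suc n. f i)" by blast
    moreover from this have "\<forall>i<n. f i \<in> A" by simp
    ultimately have "(\<Sum>i<n. f i) \<in> nsum A n" "f n \<in> A" using Suc.IH by blast+
    with f(2) show "y \<in> nsum A (Suc n)" by auto
  qed
qed simp

lemma nsum_add: "x \<in> nsum A m \<Longrightarrow> y \<in> nsum A n \<Longrightarrow> x + y \<in> nsum A (m + n)"
proof (induction n arbitrary: y)
  case (Suc n)
  then obtain z a where "y = z + a" "z \<in> nsum A n" "a \<in> A" by auto
  moreover from this have "x + z \<in> nsum A (m + n)" using Suc by blast
  ultimately have "(x + z) + a \<in> nsum A (Suc (m + n))" by auto
  with \<open>y = z + a\<close> show ?case by (simp only: add.assoc add_Suc_right)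
qed simp

lemma nsum_mono_0: "m \<le> n \<Longrightarrow> 0 \<in> A \<Longrightarrow> nsum A m \<subseteq> nsum A n"
proof (induction n rule: dec_induct)
  case (step n)
  have "z + 0 \<in> nsum A (Suc n)" if "z \<in> nsum A n" for z
    using that step.prems unfolding nsum.simps by blast
  then have "nsum A n \<subseteq> nsum A (Suc n)" by auto
  with step show ?case by auto
qed simp

lemma nsum_singleton: "x \<in> A \<Longrightarrow> x \<in> nsum A 1"
  by simp

text \<open>Expanding gives \<open>m * n\<close> products of elements of \<open>A\<close>. Hence the
  union of all sumsets of a multiplicatively closed set is itself closed under
  multiplication.\<close>

lemma nsum_mult:
  fixes A :: "'a::comm_ring_1 set"
  assumes A: "\<And>x y. x \<in> A \<Longrightarrow> y \<in> A \<Longrightarrow> x * y \<in> A"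
    and "x \<in> nsum A m" "y \<in> nsum A n"
  shows "x * y \<in> nsum A (m * n)"
proof -
  have *: "x * a \<in> nsum A m" if "a \<in> A" "x \<in> nsum A m" for x a m
    using that(2)
  proof (induction m arbitrary: x)
    case (Suc m)
    then obtain z b where "x = z + b" "z \<in> nsum A m" "b \<in> A" by auto
    moreover from this have "z * a \<in> nsum A m" "b * a \<in> A"
      using Suc.IH A that(1) by auto
    ultimately show ?case unfolding nsum.simps by (auto simp only: distrib_right)
  qed simp
  show ?thesis using assms(3)
  proof (induction n arbitrary: y)
    case (Suc n)
    then obtain z a where "y = z + a" "z \<in> nsum A n" "a \<in> A" by auto
    moreover from this have "x * z + x * a \<in> nsum A (m * n + m)"
      using Suc.IH[of z] *[OF _ assms(2), of a] by (intro nsum_add)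
    ultimately show ?case by (simp add: distrib_left add.commute)
  qed simp
qed

text \<open>The multiplicative group is cyclic of order \<open>k * d\<close>, so its
  \<open>k\<close>-th powers are its \<open>d\<close>-th roots of unity. The question about powers
  thus becomes one about sumsets.\<close>

lemma all_signed_power_sums_iff:
  assumes "k * d = CARD('a::{finite,field}) - 1"
  shows "all_signed_power_sums TYPE('a) k s \<longleftrightarrow> nsum (signed (unity_roots d)) s = (UNIV :: 'a set)"
proof -
  have pos: "k > 0" "d > 0"
    using assms finite_field_card_gt_1[where 'a = 'a] by (auto intro: Nat.gr0I)
  have powers: "unity_roots d = {x ^ k | x :: 'a. x \<noteq> 0}"
  proof (intro equalityI subsetI)
    fix y :: 'a assume "y \<in> unity_roots d"
    then have y: "y ^ d = 1" by (simp add: unity_roots_def)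
    then have "y \<noteq> 0" using pos by (auto simp: power_0_left)
    obtain g :: 'a where g: "g \<noteq> 0" "\<And>x. x \<noteq> 0 \<Longrightarrow> \<exists>m. x = g ^ m"
      "\<And>m. g ^ m = 1 \<longleftrightarrow> CARD('a) - 1 dvd m"
      using finite_field_generator[where 'a = 'a] by blast
    obtain m where m: "y = g ^ m" using g(2) \<open>y \<noteq> 0\<close> by blast
    with y have "g ^ (m * d) = 1" by (simp add: power_mult)
    then have "k * d dvd m * d" by (simp add: g(3) assms)
    then obtain j where "m = j * k" using pos by auto
    with m have "y = (g ^ j) ^ k" by (simp add: power_mult)
    with g(1) show "y \<in> {x ^ k | x. x \<noteq> 0}" by auto
  next
    fix y :: 'a assume "y \<in> {x ^ k | x. x \<noteq> 0}"
    then obtain x where "x \<noteq> 0" "y = x ^ k" by blast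
    then have "y ^ d = 1"
      using finite_field_power_eq_1[of x] by (simp add: assms flip: power_mult)
    then show "y \<in> unity_roots d" by (simp add: unity_roots_def)
  qed
  have signed: "y \<in> signed (unity_roots d) \<longleftrightarrow> (\<exists>e x. e \<in> {1, -1} \<and> y = e * x ^ k)" for y :: 'a
  proof
    assume "y \<in> signed (unity_roots d)"
    then consider "y = 0" | x where "y = x ^ k" | x where "y = - (x ^ k)"
      by (auto simp: signed_def powers)
    then show "\<exists>e x. e \<in> {1, -1} \<and> y = e * x ^ k"
    proof cases
      case 1
      then show ?thesis using pos by (intro exI[of _ 1] exI[of _ 0]) simp
    next
      case (2 x)
      then show ?thesis by (intro exI[of _ 1] exI[of _ x]) simp
    next
      case (3 x)
      then show ?thesis by (intro exI[of _ "-1"] exI[of _ x]) simp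
    qed
  next
    assume "\<exists>e x. e \<in> {1, -1} \<and> y = e * x ^ k"
    then obtain e x where "e \<in> {1, -1}" "y = e * x ^ k" by blast
    then show "y \<in> signed (unity_roots d)"
      using pos by (cases "x = 0") (auto simp: signed_def powers)
  qed
  have "y \<in> nsum (signed (unity_roots d)) s \<longleftrightarrow>
      (\<exists>e x. (\<forall>i<s. e i \<in> {1, -1}) \<and> y = (\<Sum>i<s. e i * x i ^ k))" for y :: 'a
  proof
    assume "y \<in> nsum (signed (unity_roots d)) s"
    then obtain f where f: "\<And>i. i < s \<Longrightarrow> f i \<in> signed (unity_roots d)" "y = (\<Sum>i<s. f i)"
      by (auto simp: nsum_iff)
    then have "\<forall>i\<in>{..<s}. \<exists>e x. e \<in> {1, -1} \<and> f i = e * x ^ k"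
      using signed by blast
    then obtain e x where ex: "\<forall>i\<in>{..<s}. e i \<in> {1, -1} \<and> f i = e i * x i ^ k"
      by (meson bchoice)
    then have "y = (\<Sum>i<s. e i * x i ^ k)"
      unfolding f(2) by (intro sum.cong) blast+
    with ex show "\<exists>e x. (\<forall>i<s. e i \<in> {1, -1}) \<and> y = (\<Sum>i<s. e i * x i ^ k)"
      by blast
  next
    assume "\<exists>e x. (\<forall>i<s. e i \<in> {1, -1}) \<and> y = (\<Sum>i<s. e i * x i ^ k)"
    then obtain e x where "\<forall>i<s. e i \<in> {1, -1}" "y = (\<Sum>i<s. e i * x i ^ k)"
      by blast
    then show "y \<in> nsum (signed (unity_roots d)) s"
      unfolding nsum_iff using signed by (intro exI[of _ "\<lambda>i. e i * x i ^ k"]) blast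
  qed
  then show ?thesis
    unfolding all_signed_power_sums_def by blast
qed

section \<open>Additive generation of a finite field by roots of unity\<close>

text \<open>Lagrange's theorem in the additive group; it will force the subring of signed sums to
  have order a power of \<open>p\<close>.\<close>

lemma card_additive_subgroup_dvd:
  fixes R :: "'a::{finite,field} set"
  assumes "0 \<in> R" "\<And>x y. x \<in> R \<Longrightarrow> y \<in> R \<Longrightarrow> x + y \<in> R" "\<And>x. x \<in> R \<Longrightarrow> - x \<in> R"
  shows "card R dvd CARD('a)"
proof -
  let ?R = "ring_of_type_algebra :: 'a ring"
  interpret ring ?R by (rule ring_from_type_algebra)
  have inv: "inv\<^bsub>add_monoid ?R\<^esub> x = - x" for x
    using minus_equality[of "- x" x] by (simp add: ring_of_type_algebra_def a_inv_def)
  have "subgroup R (add_monoid ?R)"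
    using assms by unfold_locales (simp_all only: inv, simp_all add: ring_of_type_algebra_def)
  then have "card R dvd Coset.order (add_monoid ?R)"
    using add.lagrange by (metis dvd_triv_right)
  then show ?thesis by (simp add: Coset.order_def ring_of_type_algebra_def)
qed

text \<open>The sumsets fill a subring \<open>R\<close> of order \<open>p ^ t\<close>. It contains
  an element \<open>w\<close> of order \<open>d\<close>, so \<open>d dvd p ^ t - 1\<close>, and
  primitivity leaves only \<open>t = n\<close>.\<close>

lemma primitive_divisor_nsum_UNIV:
  assumes "prime p" and card: "CARD('a::{finite,field}) = p ^ n"
    and d: "primitive_divisor d p n"
  shows "\<exists>s. nsum (signed (unity_roots d)) s = (UNIV :: 'a set)"
proof -
  let ?A = "signed (unity_roots d) :: 'a set"
  have dvd: "d dvd CARD('a) - 1" using d by (simp add: primitive_divisor_def card)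
  obtain w :: 'a where w: "\<And>m. w ^ m = 1 \<longleftrightarrow> d dvd m"
    "unity_roots d = range (\<lambda>m. w ^ m)" "w \<noteq> 0"
    using unity_roots_cyclic[OF dvd] by blast
  define R where "R = (\<Union>s. nsum ?A s)"
  have mult_A: "x * y \<in> ?A" if "x \<in> ?A" "y \<in> ?A" for x y
  proof -
    have "u * v \<in> unity_roots d" if "u \<in> unity_roots d" "v \<in> unity_roots d" for u v :: 'a
      using that by (simp add: unity_roots_def power_mult_distrib)
    with that show ?thesis unfolding signed_def by auto
  qed
  have A_R: "?A \<subseteq> R" unfolding R_def using nsum_singleton by blast
  have R0: "0 \<in> R" using A_R by (auto simp: signed_def)
  have R1: "1 \<in> R" using A_R by (auto simp: signed_def unity_roots_def)
  have Rm1: "-1 \<in> R" using A_R by (auto simp: signed_def unity_roots_def)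
  have R_add: "x + y \<in> R" if "x \<in> R" "y \<in> R" for x y
    using that nsum_add unfolding R_def by blast
  have R_mult: "x * y \<in> R" if "x \<in> R" "y \<in> R" for x y
    using that nsum_mult[OF mult_A] unfolding R_def by blast
  have R_minus: "- x \<in> R" if "x \<in> R" for x
    using R_mult[OF that Rm1] by simp
  have "card R dvd p ^ n"
    using card_additive_subgroup_dvd[OF R0 R_add R_minus] by (simp add: card)
  then obtain t where t: "card R = p ^ t" "t \<le> n"
    using divides_primepow_nat[OF assms(1)] by blast
  have "w \<in> R" using A_R w(2) by (auto simp: signed_def intro: range_eqI[of _ _ 1])
  then have "w ^ (p ^ t - 1) = 1"
    using finite_subring_power_eq_1[OF R0 R_mult _ w(3)] t by simp
  then have "d dvd p ^ t - 1" using w(1) by simp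
  \<comment> \<open>This case needs its own argument: \<open>d\<close> always divides
    \<open>p ^ 0 - 1 = 0\<close>, and primitivity concerns only exponents from 1 on.\<close>
  moreover have "t \<noteq> 0"
  proof
    assume "t = 0"
    then have "card R = 1" using t by simp
    moreover have "card {0, 1 :: 'a} \<le> card R" using R0 R1 by (intro card_mono) auto
    ultimately show False by simp
  qed
  ultimately have "t = n"
    using d t(2) unfolding primitive_divisor_def
    by (metis One_nat_def Suc_leI le_neq_implies_less neq0_conv)
  then have R: "R = UNIV" using t card by (intro card_subset_eq) auto
  then have "\<forall>y. \<exists>s. y \<in> nsum ?A s" unfolding R_def by blast
  then obtain s where s: "\<And>y. y \<in> nsum ?A (s y)" by metis
  \<comment> \<open>One length for all elements: the field is finite, and shorter sums are padded
    with zeros.\<close>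
  have "y \<in> nsum ?A (Max (range s))" for y
    using s[of y] nsum_mono_0[of "s y" "Max (range s)" ?A] by (auto simp: signed_def)
  then show ?thesis by blast
qed

section \<open>Integer polynomials and embeddings of finite fields\<close>

text \<open>Translation by \<open>1\<close> permutes the field, so adding \<open>CARD('a)\<close>
  leaves the sum of all elements unchanged. A field has no nonzero nilpotents, which passes from
  \<open>p ^ n\<close> to \<open>p\<close>.\<close>

lemma finite_field_of_nat_eq_0:
  assumes "CARD('a::{finite,field}) = p ^ n"
  shows "of_nat p = (0 :: 'a)"
proof -
  have "bij (\<lambda>x::'a. x + 1)"
    by (rule bij_betw_byWitness[where f' = "\<lambda>x. x - 1"]) auto
  then have "(\<Sum>x\<in>UNIV. x + 1) = (\<Sum>x\<in>UNIV. x :: 'a)"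
    by (rule sum.reindex_bij_betw)
  then have "of_nat (p ^ n) = (0 :: 'a)"
    by (simp add: sum.distrib assms)
  then show ?thesis by simp
qed

text \<open>Integer coefficients allow one polynomial to be evaluated in two fields of the same
  characteristic; it stands for a polynomial over their common prime field.\<close>

definition int_eval :: "'a::comm_ring_1 \<Rightarrow> int poly \<Rightarrow> 'a" where
  "int_eval x P = poly (map_poly of_int P) x"

lemma map_poly_of_int_mult:
  "map_poly of_int (P * Q) = map_poly of_int P * (map_poly of_int Q :: 'a::comm_ring_1 poly)"
  by (intro poly_eqI) (simp add: coeff_map_poly coeff_mult)

lemma map_poly_of_int_add:
  "map_poly of_int (P + Q) = map_poly of_int P + (map_poly of_int Q :: 'a::comm_ring_1 poly)"
  by (intro poly_eqI) (simp add: coeff_map_poly)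

lemma map_poly_of_int_diff:
  "map_poly of_int (P - Q) = map_poly of_int P - (map_poly of_int Q :: 'a::comm_ring_1 poly)"
  by (intro poly_eqI) (simp add: coeff_map_poly)

lemma map_poly_of_int_monom:
  "map_poly of_int (Polynomial.monom c n) = (Polynomial.monom (of_int c) n :: 'a::comm_ring_1 poly)"
  by (intro poly_eqI) (simp add: coeff_map_poly)

lemma int_eval_mult: "int_eval x (P * Q) = int_eval x P * int_eval x Q"
  by (simp add: int_eval_def map_poly_of_int_mult)

lemma int_eval_add: "int_eval x (P + Q) = int_eval x P + int_eval x Q"
  by (simp add: int_eval_def map_poly_of_int_add)

lemma int_eval_diff: "int_eval x (P - Q) = int_eval x P - int_eval x Q"
  by (simp add: int_eval_def map_poly_of_int_diff)

lemma int_eval_monom: "int_eval x (Polynomial.monom c n) = of_int c * x ^ n"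
  by (simp add: int_eval_def map_poly_of_int_monom poly_monom)

lemma degree_monom_diff_1:
  assumes "c > 0"
  shows "degree (Polynomial.monom 1 c - 1 :: 'a::comm_ring_1 poly) = c"
proof (rule antisym)
  show "degree (Polynomial.monom 1 c - 1 :: 'a poly) \<le> c"
    by (intro degree_diff_le degree_monom_le) simp
  show "c \<le> degree (Polynomial.monom 1 c - 1 :: 'a poly)"
    using assms by (intro le_degree) simp
qed

lemma dvd_coeffs_of_int_eval_eq_0:
  fixes u :: "'a::comm_ring_1"
  assumes p: "prime p" "of_nat p = (0 :: 'a)"
    and min: "\<And>g. lead_coeff g = 1 \<Longrightarrow> int_eval u g = 0 \<Longrightarrow> N \<le> degree g"
    and "int_eval u r = 0" "degree r < N"
  shows "int p dvd Polynomial.coeff r i"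
  using assms(4,5)
proof (induction "degree r" arbitrary: r rule: less_induct)
  case less
  let ?d = "degree r" and ?l = "lead_coeff r"
  have p_dvd: "of_int m = (0 :: 'a)" if "int p dvd m" for m
    using that p(2) by (auto simp: dvd_def)
  have "int p dvd ?l"
  proof (rule ccontr)
    assume "\<not> int p dvd ?l"
    then have "coprime ?l (int p)"
      using p(1) by (simp add: prime_imp_coprime coprime_commute)
    \<comment> \<open>These coefficients make \<open>?g\<close> monic over the integers, while the
      added monomial vanishes at \<open>u\<close> because \<open>p\<close> is zero there.\<close>
    then obtain m k where mk: "m * ?l + k * int p = 1"
      using bezout_int[of ?l "int p"] by auto
    let ?g = "smult m r + Polynomial.monom (int p * k) ?d"
    have coeff: "Polynomial.coeff ?g ?d = 1" using mk by (simp add: mult.commute)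
    moreover have "degree ?g \<le> ?d"
      by (intro degree_add_le degree_smult_le degree_monom_le)
    moreover have "?d \<le> degree ?g" using coeff le_degree[of ?g ?d] by linarith
    ultimately have "degree ?g = ?d" "lead_coeff ?g = 1" by simp_all
    moreover have "int_eval u ?g = 0"
    proof -
      have "int_eval u (Polynomial.monom m 0 * r) = 0"
        unfolding int_eval_mult using less.prems by simp
      then show ?thesis
        unfolding int_eval_add int_eval_monom using p(2) by (simp add: monom_0)
    qed
    ultimately show False using min[of ?g] less.prems by simp
  qed
  show ?case
  proof (cases "?d = 0")
    case True
    then show ?thesis
      using \<open>int p dvd ?l\<close> coeff_eq_0[of r i] by (cases "i = 0") auto
  next
    case False
    let ?r = "r - Polynomial.monom ?l ?d"
    have "degree ?r \<le> ?d"
      by (intro degree_diff_le degree_monom_le) simp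
    moreover have "Polynomial.coeff ?r ?d = 0" by simp
    ultimately have deg: "degree ?r < ?d"
      using False eq_zero_or_degree_less[of ?r ?d] by auto
    have "int_eval u ?r = 0"
      unfolding int_eval_diff int_eval_monom using less.prems p_dvd[OF \<open>int p dvd ?l\<close>] by simp
    then have "int p dvd Polynomial.coeff ?r i"
      using less.hyps[OF deg] deg less.prems by simp
    then show ?thesis using \<open>int p dvd ?l\<close> by (cases "i = ?d") auto
  qed
qed

text \<open>
  Let \<open>f\<close> be a monic integer polynomial of least degree vanishing at \<open>u\<close>. Modulo \<open>p\<close> it divides
  every polynomial vanishing at \<open>u\<close>, in particular \<open>X\<^sup>c - 1\<close>, which has \<open>c\<close> distinct roots in
  \<open>'l\<close>; the cofactor has fewer roots, so \<open>f\<close> has a root in \<open>'l\<close>.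
\<close>

lemma conjugate_root_exists:
  fixes u :: "'k::comm_ring_1"
  assumes p: "prime p" "of_nat p = (0 :: 'k)" "of_nat p = (0 :: 'l::{finite,field})"
    and u: "u ^ c = 1" and c: "c dvd CARD('l) - 1" and "c > 0"
  shows "\<exists>v::'l. \<forall>P. int_eval u P = 0 \<longrightarrow> int_eval v P = 0"
proof -
  let ?M = "map_poly of_int :: int poly \<Rightarrow> 'l poly"
  let ?X = "Polynomial.monom 1 c - 1 :: int poly"
  let ?Z = "\<lambda>f. lead_coeff f = 1 \<and> int_eval u f = 0"
  have X: "?Z ?X"
  proof
    show "lead_coeff ?X = 1"
      unfolding degree_monom_diff_1[OF \<open>c > 0\<close>] using \<open>c > 0\<close> by simp
    have "int_eval u (Polynomial.monom 1 c - Polynomial.monom 1 0) = 0"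
      unfolding int_eval_diff int_eval_monom by (simp add: u)
    then show "int_eval u ?X = 0" by simp
  qed
  obtain f where f: "?Z f" and min: "\<And>g. ?Z g \<Longrightarrow> degree f \<le> degree g"
    using ex_has_least_nat[of ?Z ?X degree] X by blast
  have f0: "f \<noteq> 0" using f by auto
  have division: "\<exists>Q. ?M P = ?M f * Q" if P: "int_eval u P = 0" for P
  proof -
    \<comment> \<open>Pseudo-division scales \<open>P\<close> by a power of the lead coefficient of
      \<open>f\<close>; this is \<open>1\<close>, so the result is a true division with remainder
      over the integers.\<close>
    obtain q r where qr: "pseudo_divmod P f = (q, r)" by fastforce
    have eq: "P = f * q + r" and deg: "r = 0 \<or> degree r < degree f"
      using pseudo_divmod[OF f0 qr] f by simp_all
    have "int_eval u r = 0"
      using P f unfolding eq int_eval_add int_eval_mult by simp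
    have "int p dvd Polynomial.coeff r i" for i
    proof (cases "r = 0")
      case False
      with deg have "degree r < degree f" by blast
      with min show ?thesis
        by (intro dvd_coeffs_of_int_eval_eq_0[OF p(1,2) _ \<open>int_eval u r = 0\<close>,
              where N = "degree f"]) blast+
    qed simp
    moreover have "of_int k = (0 :: 'l)" if "int p dvd k" for k
      using that p(3) by (auto simp: dvd_def)
    ultimately have "?M r = 0"
      by (intro poly_eqI) (simp add: coeff_map_poly)
    then show ?thesis unfolding eq map_poly_of_int_add map_poly_of_int_mult by auto
  qed
  obtain Q where Q: "?M ?X = ?M f * Q" using division X by blast
  have MX: "?M ?X = Polynomial.monom 1 c - 1"
    by (simp add: map_poly_of_int_diff map_poly_of_int_monom)
  have degX: "degree (?M ?X) = c"
    unfolding MX by (rule degree_monom_diff_1[OF \<open>c > 0\<close>])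
  then have nz: "?M f \<noteq> 0" "Q \<noteq> 0" using \<open>c > 0\<close> unfolding Q by auto
  have "degree f \<noteq> 0"
  proof
    assume "degree f = 0"
    then obtain k where "f = [:k:]" by (rule degree_eq_zeroE)
    then have "f = 1" using f by (simp add: one_pCons)
    then have "(1 :: 'k) = 0" using f by (simp add: int_eval_def)
    then show False by simp
  qed
  \<comment> \<open>The lead coefficient \<open>1\<close> survives the passage to \<open>'l\<close>,
    so \<open>?M f\<close> is not constant and the cofactor \<open>Q\<close> has degree below
    \<open>c\<close>.\<close>
  moreover have "Polynomial.coeff (?M f) (degree f) = 1" using f by (simp add: coeff_map_poly)
  ultimately have "degree (?M f) > 0" using le_degree[of "?M f" "degree f"] by simp
  then have "degree Q < c" using degX nz unfolding Q by (simp add: degree_mult_eq)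
  then have "card {x. poly Q x = 0} < card (unity_roots c :: 'l set)"
    using card_poly_roots_bound[OF nz(2)] card_unity_roots[OF c] by simp
  then have "\<not> unity_roots c \<subseteq> {x. poly Q x = 0}"
    by (metis card_mono finite leD)
  then obtain v where v: "v ^ c = 1" "poly Q v \<noteq> 0" by (auto simp: unity_roots_def)
  have "poly (?M ?X) v = 0" unfolding MX using v by (simp add: poly_monom)
  then have "poly (?M f) v = 0" unfolding Q using v by simp
  then have "int_eval v P = 0" if "int_eval u P = 0" for P
    using division[OF that] by (auto simp: int_eval_def)
  then show ?thesis by blast
qed

text \<open>Take \<open>u\<close> of order \<open>c\<close> in \<open>'k\<close> and a conjugate
  \<open>v\<close> in \<open>'l\<close>, which exists as \<open>c dvd p ^ n - 1\<close>. The map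
  sends \<open>P(u)\<close> to \<open>P(v)\<close>; it is defined everywhere because, by
  primitivity, signed sums of powers of \<open>u\<close> fill \<open>'k\<close>.\<close>

lemma finite_field_embedding:
  assumes "prime p" "CARD('k::{finite,field}) = p ^ a" "CARD('l::{finite,field}) = p ^ n"
    and c: "primitive_divisor c p a" and dvd: "c dvd p ^ n - 1"
  obtains \<phi> :: "'k::{finite,field} \<Rightarrow> 'l::{finite,field}" where "\<phi> 1 = 1" "\<And>x y. \<phi> (x + y) = \<phi> x + \<phi> y"
    "\<And>x y. \<phi> (x * y) = \<phi> x * \<phi> y"
proof -
  have "c dvd CARD('k) - 1" using c assms(2) by (simp add: primitive_divisor_def)
  then obtain u :: 'k where u: "\<And>m. u ^ m = 1 \<longleftrightarrow> c dvd m" "unity_roots c = range (\<lambda>m. u ^ m)"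
    using unity_roots_cyclic[OF \<open>c dvd CARD('k) - 1\<close>] by blast
  have "c > 0" using \<open>c dvd CARD('k) - 1\<close> finite_field_card_gt_1[where 'a = 'k]
    by (auto intro: Nat.gr0I)
  have "u ^ c = 1" "c dvd CARD('l) - 1" using u(1) dvd assms(3) by simp_all
  then have "\<exists>v::'l. \<forall>P. int_eval u P = 0 \<longrightarrow> int_eval v P = 0"
    by (rule conjugate_root_exists[OF assms(1) finite_field_of_nat_eq_0[OF assms(2)]
        finite_field_of_nat_eq_0[OF assms(3)] _ _ \<open>c > 0\<close>])
  then obtain v :: 'l where "\<forall>P. int_eval u P = 0 \<longrightarrow> int_eval v P = 0" ..
  then have v: "int_eval v P = 0" if "int_eval u P = 0" for P using that by simp
  have surj: "\<exists>P. int_eval u P = y" for y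
  proof -
    obtain s where "nsum (signed (unity_roots c)) s = (UNIV :: 'k set)"
      using primitive_divisor_nsum_UNIV[OF assms(1,2) c] by blast
    then have "y \<in> nsum (signed (unity_roots c)) s" by simp
    then show ?thesis
    proof (induction s arbitrary: y)
      case 0
      then show ?case by (intro exI[of _ 0]) (simp add: int_eval_def)
    next
      case (Suc s)
      then obtain z x where zx: "y = z + x" "z \<in> nsum (signed (unity_roots c)) s"
        "x \<in> signed (unity_roots c)"
        by auto
      obtain P where P: "int_eval u P = z" using Suc.IH[OF zx(2)] by blast
      from zx(3) consider "x = 0" | m where "x = u ^ m" | m where "x = - (u ^ m)"
        by (auto simp: signed_def u(2))
      then have "\<exists>k m. x = int_eval u (Polynomial.monom k m)"
      proof cases
        case 1
        then show ?thesis by (intro exI[of _ 0]) (simp add: int_eval_def)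
      next
        case (2 m)
        then show ?thesis by (intro exI[of _ 1] exI[of _ m]) (simp add: int_eval_monom)
      next
        case (3 m)
        then show ?thesis by (intro exI[of _ "-1"] exI[of _ m]) (simp add: int_eval_monom)
      qed
      then obtain k m where "x = int_eval u (Polynomial.monom k m)" by blast
      with zx(1) P have "int_eval u (P + Polynomial.monom k m) = y" by (simp only: int_eval_add)
      then show ?case by blast
    qed
  qed
  \<comment> \<open>The choice of \<open>P\<close> does not matter: polynomials that agree at
    \<open>u\<close> agree at \<open>v\<close>.\<close>
  define \<phi> where "\<phi> y = int_eval v (SOME P. int_eval u P = y)" for y
  have phi: "\<phi> (int_eval u P) = int_eval v P" for P
  proof -
    let ?Q = "SOME Q. int_eval u Q = int_eval u P"
    have "int_eval u ?Q = int_eval u P" by (rule someI) (rule refl)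
    then have "int_eval u (?Q - P) = 0" by (simp add: int_eval_diff)
    then have "int_eval v (?Q - P) = 0" by (rule v)
    then show ?thesis by (simp add: int_eval_diff \<phi>_def)
  qed
  have "\<phi> 1 = 1" using phi[of "Polynomial.monom 1 0"] unfolding int_eval_monom by simp
  moreover have "\<phi> (x + y) = \<phi> x + \<phi> y" "\<phi> (x * y) = \<phi> x * \<phi> y" for x y
  proof -
    obtain P where P: "int_eval u P = x" using surj[of x] ..
    obtain Q where Q: "int_eval u Q = y" using surj[of y] ..
    show "\<phi> (x + y) = \<phi> x + \<phi> y" "\<phi> (x * y) = \<phi> x * \<phi> y"
      unfolding P[symmetric] Q[symmetric]
      by (simp_all only: phi flip: int_eval_add int_eval_mult)
  qed
  ultimately show ?thesis by (rule that)
qed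

section \<open>Coordinates along the powers of \<open>w\<close> and comparison of the Waring
  numbers\<close>

theorem theorem8p9:
  fixes p a b c :: nat
  assumes "prime p" and "a > 0" and "b > 0" and "c > 0"
    and "primitive_divisor c p a"
    and "primitive_divisor (b * c) p (a * b)"
    and "CARD('k::{finite,field}) = p ^ a"
    and "CARD('l::{finite,field}) = p ^ (a * b)"
  shows "weak_waring_exists TYPE('k) ((p ^ a - 1) div c) \<and>
         weak_waring_exists TYPE('l) ((p ^ (a * b) - 1) div (b * c)) \<and>
         weak_waring TYPE('l) ((p ^ (a * b) - 1) div (b * c)) =
           b * weak_waring TYPE('k) ((p ^ a - 1) div c)"
proof -
  have dvd_k: "c dvd CARD('k) - 1" and dvd_l: "b * c dvd CARD('l) - 1"
    using assms by (simp_all add: primitive_divisor_def)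
  then have dvd_lc: "c dvd CARD('l) - 1" using dvd_mult_right by blast
  let ?A = "signed (unity_roots c) :: 'k set" and ?B = "signed (unity_roots (b * c)) :: 'l set"
  have all_k: "all_signed_power_sums TYPE('k) ((p ^ a - 1) div c) s \<longleftrightarrow> nsum ?A s = UNIV" for s
    using dvd_k assms(7) by (intro all_signed_power_sums_iff) simp
  have all_l: "all_signed_power_sums TYPE('l) ((p ^ (a * b) - 1) div (b * c)) s \<longleftrightarrow>
      nsum ?B s = UNIV" for s
    using dvd_l assms(8) by (intro all_signed_power_sums_iff) (simp del: mult_Suc)
  have ex_k: "\<exists>s. nsum ?A s = UNIV" and ex_l: "\<exists>s. nsum ?B s = UNIV"
    using primitive_divisor_nsum_UNIV assms by blast+

  obtain \<phi> :: "'k \<Rightarrow> 'l" where \<phi>: "\<phi> 1 = 1" "\<And>x y. \<phi> (x + y) = \<phi> x + \<phi> y"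
    "\<And>x y. \<phi> (x * y) = \<phi> x * \<phi> y"
    using finite_field_embedding[OF assms(1,7,8,5)] dvd_lc assms(8) by auto
  have \<phi>0: "\<phi> 0 = 0" using \<phi>(2)[of 0 0] by (metis add.right_neutral add_left_cancel)
  have \<phi>_minus: "\<phi> (- x) = - \<phi> x" for x
    using \<phi>(2)[of x "- x"] \<phi>0 by (simp add: eq_neg_iff_add_eq_0 add.commute)
  have \<phi>_power: "\<phi> (x ^ n) = \<phi> x ^ n" for x n
    by (induction n) (simp_all add: \<phi>)
  have "inj \<phi>"
  proof (rule injI)
    fix x y assume "\<phi> x = \<phi> y"
    then have "\<phi> (x - y) = 0" using \<phi>(2)[of x "- y"] \<phi>_minus[of y] by simp
    then have "\<phi> ((x - y) * inverse (x - y)) = 0" by (simp add: \<phi>(3))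
    then show "x = y" using \<phi>(1) by (cases "x = y") auto
  qed
  \<comment> \<open>Both fields contain exactly \<open>c\<close> such roots, so by injectivity those
    of \<open>'l\<close> all come from \<open>'k\<close>.\<close>
  have \<phi>_roots: "\<phi> ` unity_roots c = unity_roots c"
  proof (rule card_subset_eq)
    show "\<phi> ` unity_roots c \<subseteq> unity_roots c"
      by (auto simp: unity_roots_def \<phi>(1) simp flip: \<phi>_power)
    show "card (\<phi> ` unity_roots c) = card (unity_roots c :: 'l set)"
      using inj_on_subset[OF \<open>inj \<phi>\<close>] dvd_k dvd_lc by (simp add: card_image card_unity_roots)
  qed simp

  obtain w :: 'l where w: "\<And>m. w ^ m = 1 \<longleftrightarrow> b * c dvd m"
    "unity_roots (b * c) = range (\<lambda>m. w ^ m)"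
    using unity_roots_cyclic[OF dvd_l] by blast
  have roots_l: "\<exists>x\<in>unity_roots c. \<exists>i<b. y = \<phi> x * w ^ i" if "y \<in> unity_roots (b * c)" for y
  proof -
    obtain m where m: "y = w ^ m" using \<open>y \<in> _\<close> w(2) by auto
    \<comment> \<open>Division of the exponent by \<open>b\<close> splits off a power of
      \<open>w ^ b\<close>, which is a \<open>c\<close>-th root of unity and hence a scalar from
      \<open>'k\<close>.\<close>
    have "(w ^ (b * (m div b))) ^ c = 1"
      unfolding power_mult[symmetric] w(1) by (simp add: mult.assoc mult.commute[of c])
    then have "w ^ (b * (m div b)) \<in> \<phi> ` unity_roots c"
      unfolding \<phi>_roots by (simp add: unity_roots_def)
    moreover have "y = w ^ (b * (m div b)) * w ^ (m mod b)"
      unfolding m by (simp flip: power_add)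
    ultimately show ?thesis using \<open>b > 0\<close> by (auto intro!: exI[of _ "m mod b"])
  qed
  \<comment> \<open>Together with \<open>B_I\<close> below: the admissible terms in
    \<open>'l\<close> are those with a single coordinate, which is an admissible term in
    \<open>'k\<close>.\<close>
  have B_D: "\<exists>x\<in>?A. \<exists>i<b. y = \<phi> x * w ^ i" if "y \<in> ?B" for y
  proof -
    consider "y = 0" | "y \<in> unity_roots (b * c)" | "- y \<in> unity_roots (b * c)"
      using \<open>y \<in> ?B\<close> by (auto simp: signed_def)
    then show ?thesis
    proof cases
      case 1
      then show ?thesis using \<open>b > 0\<close> \<phi>0 by (intro bexI[of _ 0]) (auto simp: signed_def)
    next
      case 2
      then show ?thesis using roots_l[of y] unfolding signed_def by blast
    next
      case 3
      then obtain x i where "x \<in> unity_roots c" "i < b" "- y = \<phi> x * w ^ i"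
        using roots_l by blast
      moreover from this have "y = \<phi> (- x) * w ^ i"
        by (metis \<phi>_minus minus_minus mult_minus_left)
      ultimately show ?thesis unfolding signed_def by blast
    qed
  qed
  have B_I: "\<phi> x * w ^ i \<in> ?B" if "x \<in> ?A" for x i
  proof -
    have *: "\<phi> r * w ^ i \<in> unity_roots (b * c)" if "r \<in> unity_roots c" for r
    proof -
      have "(\<phi> r) ^ c = 1" using \<phi>_roots that by (auto simp: unity_roots_def)
      then have "\<phi> r ^ (b * c) = 1" by (metis mult.commute power_mult power_one)
      moreover have "(w ^ i) ^ (b * c) = 1"
        unfolding power_mult[symmetric] w(1) by simp
      ultimately show ?thesis by (simp add: unity_roots_def power_mult_distrib)
    qed
    from that consider "x = 0" | "x \<in> unity_roots c" | r where "r \<in> unity_roots c" "x = - r"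
      unfolding signed_def by auto
    then show ?thesis
      by cases (use * in \<open>auto simp: signed_def \<phi>0 \<phi>_minus\<close>)
  qed

  \<comment> \<open>\<open>T y\<close> is the element with coordinates \<open>y 0\<close>, ...,
    \<open>y (b - 1)\<close>; values of \<open>y\<close> from \<open>b\<close> on do not affect
    it.\<close>
  define T where "T y = (\<Sum>i<b. \<phi> (y i) * w ^ i)" for y
  \<comment> \<open>Each of the \<open>s\<close> terms changes one coordinate by one element of
    \<open>?A\<close>; \<open>n i\<close> counts the terms spent on coordinate
    \<open>i\<close>.\<close>
  have split: "\<exists>y n. z = T y \<and> (\<forall>i<b. y i \<in> nsum ?A (n i)) \<and> (\<Sum>i<b. n i) = s"
    if "z \<in> nsum ?B s" for z s
    using that
  proof (induction s arbitrary: z)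
    case 0
    then show ?case
      by (intro exI[of _ "\<lambda>_. 0"]) (auto simp: T_def \<phi>0)
  next
    case (Suc s)
    then obtain z' t where z: "z = z' + t" "z' \<in> nsum ?B s" "t \<in> ?B" by auto
    obtain y n where yn: "z' = T y" "\<forall>i<b. y i \<in> nsum ?A (n i)" "(\<Sum>i<b. n i) = s"
      using Suc.IH[OF z(2)] by blast
    obtain x j where xj: "x \<in> ?A" "j < b" "t = \<phi> x * w ^ j" using B_D[OF z(3)] by blast
    have "T (y(j := y j + x)) = (\<Sum>i<b. \<phi> (y i) * w ^ i + (if i = j then t else 0))"
      unfolding T_def by (intro sum.cong) (auto simp: \<phi>(2) distrib_right xj(3))
    then have "T (y(j := y j + x)) = z"
      using xj(2) by (simp add: sum.distrib z(1) yn(1) T_def)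
    moreover have "(\<Sum>i<b. (n(j := Suc (n j))) i) = (\<Sum>i<b. n i + (if i = j then 1 else 0))"
      by (intro sum.cong) auto
    then have "(\<Sum>i<b. (n(j := Suc (n j))) i) = Suc s"
      using xj(2) yn(3) by (simp only: sum.distrib) simp
    moreover have "\<forall>i<b. (y(j := y j + x)) i \<in> nsum ?A ((n(j := Suc (n j))) i)"
      using yn(2) xj(1) by auto
    ultimately show ?case by blast
  qed
  have join1: "\<phi> x * w ^ i \<in> nsum ?B n" if "x \<in> nsum ?A n" for x n i
    using that
  proof (induction n arbitrary: x)
    case 0
    then show ?case by (simp add: \<phi>0)
  next
    case (Suc n)
    then obtain z t where "x = z + t" "z \<in> nsum ?A n" "t \<in> ?A" by auto
    then show ?case using Suc.IH[of z] B_I[of t i] by (auto simp: \<phi>(2) distrib_right)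
  qed
  have join: "T y \<in> nsum ?B (b * n)" if "\<And>i. y i \<in> nsum ?A n" for y n
  proof -
    have "(\<Sum>i<m. \<phi> (y i) * w ^ i) \<in> nsum ?B (m * n)" for m
    proof (induction m)
      case (Suc m)
      from nsum_add[OF this join1[OF that]] show ?case by (simp add: add.commute)
    qed simp
    then show ?thesis by (simp add: T_def)
  qed

  have T_surj: "\<exists>y. z = T y" for z
  proof -
    obtain s where "z \<in> nsum ?B s" using ex_l by blast
    then show ?thesis using split by blast
  qed
  have T_restrict: "T (restrict y {..<b}) = T y" for y
    unfolding T_def by (intro sum.cong) auto
  \<comment> \<open>Extensional functions make the coordinate vectors countable: there are
    \<open>(p ^ a) ^ b = CARD('l)\<close> of them, so surjectivity of \<open>T\<close> gives
    injectivity, that is, linear independence of the powers of \<open>w\<close>.\<close>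
  let ?F = "{..<b} \<rightarrow>\<^sub>E (UNIV :: 'k set)"
  have "T ` ?F = UNIV"
  proof -
    have "z \<in> T ` ?F" for z
    proof -
      obtain y where "z = T y" using T_surj by blast
      then show ?thesis
        by (intro image_eqI[of _ _ "restrict y {..<b}"]) (auto simp: T_restrict)
    qed
    then show ?thesis by blast
  qed
  moreover have "card ?F = CARD('l)"
    by (simp add: card_PiE assms power_mult)
  ultimately have "inj_on T ?F"
    by (intro eq_card_imp_inj_on) (simp_all add: finite_PiE)
  have T_inj: "y i = y' i" if "T y = T y'" "i < b" for y y' i
  proof -
    have "T (restrict y {..<b}) = T (restrict y' {..<b})" using that T_restrict by simp
    then have "restrict y {..<b} = restrict y' {..<b}"
      by (rule inj_onD[OF \<open>inj_on T ?F\<close>]) auto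
    then show ?thesis using that(2) by (metis lessThan_iff restrict_apply')
  qed

  define m where "m = (LEAST s. nsum ?A s = UNIV)"
  have m: "nsum ?A m = UNIV" unfolding m_def using ex_k by (rule LeastI_ex)
  have "(LEAST s. nsum ?B s = UNIV) = b * m"
  proof (rule Least_equality)
    have "z \<in> nsum ?B (b * m)" for z
    proof -
      obtain y where "z = T y" using T_surj by blast
      then show ?thesis using join[of y m] m by simp
    qed
    then show "nsum ?B (b * m) = UNIV" by blast
  next
    fix s assume s: "nsum ?B s = UNIV"
    show "b * m \<le> s"
    proof (cases m)
      case (Suc m')
      then have "nsum ?A m' \<noteq> UNIV" unfolding m_def by (intro not_less_Least) simp
      \<comment> \<open>A worst case in \<open>'k\<close>: \<open>m' = m - 1\<close> terms do not
        suffice for \<open>x\<close>. It is placed in all \<open>b\<close> coordinates at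
        once.\<close>
      then obtain x where x: "x \<notin> nsum ?A m'" by blast
      obtain y n where yn: "T (\<lambda>_. x) = T y" "\<forall>i<b. y i \<in> nsum ?A (n i)" "(\<Sum>i<b. n i) = s"
        using split[of "T (\<lambda>_. x)" s] s by blast
      \<comment> \<open>Coordinates are unique, so \<open>y i = x\<close>; a representation with at
        most \<open>m'\<close> terms could be padded to exactly \<open>m'\<close>, contrary to the
        choice of \<open>x\<close>.\<close>
      have "m \<le> n i" if "i < b" for i
      proof (rule ccontr)
        assume "\<not> m \<le> n i"
        then have "nsum ?A (n i) \<subseteq> nsum ?A m'"
          using Suc by (intro nsum_mono_0) (auto simp: signed_def)
        then show False using x yn(2) T_inj[OF yn(1) that] that by auto
      qed
      then have "(\<Sum>i<b. m) \<le> (\<Sum>i<b. n i)" by (intro sum_mono) simp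
      then show ?thesis using yn(3) by simp
    qed simp
  qed
  then show ?thesis
    using ex_k ex_l unfolding weak_waring_exists_def weak_waring_def all_k all_l m_def by blast
qed

end
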